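(* Bond percolation with edge retention probability $\pi\in[0,1]$ on a random intersection graph with communities with parameters $\boldsymbol d^{\ell}$ and $\mathbf{Com}$ is equivalent to a random intersection graph with communities with parameters $\boldsymbol d^{\ell}$ and the (random) percolated community list $\mathbf{Com}(\pi)$. Formally, as random multigraphs on $[N_n]$, $$\mathrm{RIGC}(\boldsymbol d^{\ell},\mathbf{Com})(\pi)\ \overset{d}{=}\ \mathrm{RIGC}(\boldsymbol d^{\ell},\mathbf{Com}(\pi)),$$ where the right-hand side is obtained by first sampling $\mathbf{Com}(\pi)$ and then, given $\mathbf{Com}(\pi)$, constructing the RIGC with an independent uniform matching.
   Context: Model. There are $N_n$ individuals ($\ell$-vertices) $[N_n]$ and $M_n$ groups ($r$-vertices) $[M_n]$. Let $\mathscr H$ be the set of finite, simple, connected graphs $H$ with at least one vertex, each vertex-labelled by $[|H|]$, such that isomorphic graphs in $\mathscr H$ are labelled identically ($|H|$ is the number of vertices). Parameters: $\boldsymbol d^{\ell}=(d^{\ell}_v)_{v\in[N_n]}$ with $d^{\ell}_v$ positive integers, and $\mathbf{Com}=(\mathrm{Com}_a)_{a\in[M_n]}$ with $\mathrm{Com}_a\in\mathscr H$ and $\sum_v d^{\ell}_v=\sum_a|\mathrm{Com}_a|$. Let $\mathscr V(\mathbf{Com})$ and $\mathscr E(\mathbf{Com})$ be the disjoint unions of the vertex sets and edge sets of all $\mathrm{Com}_a$. Give each $v\in[N_n]$ $d_v^{\ell}$ half-edges and let $\omega_n$ be a uniformly random bijection from the set of all these $\ell$-half-edges to $\mathscr V(\mathbf{Com})$.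 Write $v\mapsfrom j$ if a half-edge of $v$ is matched to $j\in\mathscr V(\mathbf{Com})$. The graph $\mathrm{RIGC}(\boldsymbol d^{\ell},\mathbf{Com})$ is the random multigraph on $[N_n]$ in which the pair $(v,w)$ has edge multiplicity $X(v,w)=\sum_{(j_1,j_2)\in\mathscr E(\mathbf{Com})}\mathbf 1_{\{v\mapsfrom j_1,\,w\mapsfrom j_2\}\cup\{v\mapsfrom j_2,\,w\mapsfrom j_1\}}$. Percolation on the RIGC. Given the realization of $\mathrm{RIGC}(\boldsymbol d^{\ell},\mathbf{Com})$, retain each edge (each copy of a multi-edge separately) independently with probability $\pi$ and otherwise delete it; the result is $\mathrm{RIGC}(\boldsymbol d^{\ell},\mathbf{Com})(\pi)$. Percolated community list. Independently of $\omega_n$, retain each $e\in\mathscr E(\mathbf{Com})$ independently with probability $\pi$; let $\mathrm{Com}_a(\pi)$ be the resulting (possibly disconnected) random graph on the vertex set of $\mathrm{Com}_a$. Replace $\mathrm{Com}_a(\pi)$ by the list of its $c(\mathrm{Com}_a(\pi))$ connected components, each viewed as an element of $\mathscr H$. The concatenated list over all $a\in[M_n]$, of length $M_n(\pi)=\sum_{a\in[M_n]}c(\mathrm{Com}_a(\pi))$, is $\mathbf{Com}(\pi)=(\mathrm{Com}^{\pi}_{a'})_{a'\in[M_n(\pi)]}$. *)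

theory Defs
  imports "HOL-Probability.Product_PMF"
begin

section \<open>Finite simple graphs\<close>

text \<open>A graph is a pair of a vertex set and a set of edges, an edge being the set of its two
  endpoints.\<close>

type_synonym graph = "nat set \<times> nat set set"

abbreviation verts :: "graph \<Rightarrow> nat set" where "verts \<equiv> fst"
abbreviation edges :: "graph \<Rightarrow> nat set set" where "edges \<equiv> snd"

definition simple_graph :: "graph \<Rightarrow> bool" where
  "simple_graph G \<longleftrightarrow> finite (verts G) \<and> (\<forall>e\<in>edges G. e \<subseteq> verts G \<and> card e = 2)"

definition adj :: "graph \<Rightarrow> (nat \<times> nat) set" where
  "adj G = {(u, v). {u, v} \<in> edges G}"

definition connected_graph :: "graph \<Rightarrow> bool" where
  "connected_graph G \<longleftrightarrow> verts G \<noteq> {} \<and> (\<forall>u\<in>verts G. \<forall>v\<in>verts G. (u, v) \<in> (adj G)\<^sup>*)"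

definition graph_iso :: "graph \<Rightarrow> graph \<Rightarrow> bool" where
  "graph_iso G H \<longleftrightarrow>
     (\<exists>f. bij_betw f (verts G) (verts H) \<and>
          (\<forall>u\<in>verts G. \<forall>v\<in>verts G. {u, v} \<in> edges G \<longleftrightarrow> {f u, f v} \<in> edges H))"

text \<open>\<open>\<H>\<close> consists of exactly one labelled copy, with label set \<open>{1..n}\<close>, of every finite simple
  connected graph up to isomorphism. Which labelling represents an isomorphism class is left
  open.\<close>

definition community_graphs :: "graph set \<Rightarrow> bool" where
  "community_graphs \<H> \<longleftrightarrow>
     (\<forall>H\<in>\<H>. simple_graph H \<and> connected_graph H \<and> verts H = {1..card (verts H)}) \<and>
     (\<forall>H\<in>\<H>. \<forall>H'\<in>\<H>. graph_iso H H' \<longrightarrow> H = H') \<and>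
     (\<forall>G. simple_graph G \<and> connected_graph G \<longrightarrow> (\<exists>H\<in>\<H>. graph_iso G H))"

lemma graph_iso_sym: "graph_iso G H \<Longrightarrow> graph_iso H G"
proof -
  assume "graph_iso G H"
  then obtain f where f: "bij_betw f (verts G) (verts H)"
    and e: "\<forall>u\<in>verts G. \<forall>v\<in>verts G. {u, v} \<in> edges G \<longleftrightarrow> {f u, f v} \<in> edges H"
    unfolding graph_iso_def by blast
  let ?g = "inv_into (verts G) f"
  have g: "bij_betw ?g (verts H) (verts G)" using f by (rule bij_betw_inv_into)
  have "{u, v} \<in> edges H \<longleftrightarrow> {?g u, ?g v} \<in> edges G" if "u \<in> verts H" "v \<in> verts H" for u v
  proof -
    have "?g u \<in> verts G" "?g v \<in> verts G" using g that by (auto simp: bij_betw_def)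
    moreover have "f (?g u) = u" "f (?g v) = v"
      using f that by (auto simp: bij_betw_inv_into_right)
    ultimately show ?thesis using e by metis
  qed
  then show ?thesis unfolding graph_iso_def using g by blast
qed

lemma graph_iso_trans: "graph_iso G H \<Longrightarrow> graph_iso H K \<Longrightarrow> graph_iso G K"
proof -
  assume "graph_iso G H" "graph_iso H K"
  then obtain f g where f: "bij_betw f (verts G) (verts H)"
    and ef: "\<forall>u\<in>verts G. \<forall>v\<in>verts G. {u, v} \<in> edges G \<longleftrightarrow> {f u, f v} \<in> edges H"
    and g: "bij_betw g (verts H) (verts K)"
    and eg: "\<forall>u\<in>verts H. \<forall>v\<in>verts H. {u, v} \<in> edges H \<longleftrightarrow> {g u, g v} \<in> edges K"
    unfolding graph_iso_def by blast
  have "bij_betw (g \<circ> f) (verts G) (verts K)" using f g by (rule bij_betw_trans)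
  moreover have "\<forall>u\<in>verts G. \<forall>v\<in>verts G. {u, v} \<in> edges G \<longleftrightarrow> {(g \<circ> f) u, (g \<circ> f) v} \<in> edges K"
  proof (intro ballI)
    fix u v assume uv: "u \<in> verts G" "v \<in> verts G"
    then have "f u \<in> verts H" "f v \<in> verts H" using f by (auto simp: bij_betw_def)
    then show "{u, v} \<in> edges G \<longleftrightarrow> {(g \<circ> f) u, (g \<circ> f) v} \<in> edges K"
      using uv ef eg by simp
  qed
  ultimately show ?thesis unfolding graph_iso_def by blast
qed

lemma ex_labelled_copy:
  assumes G: "simple_graph G" "connected_graph G"
  shows "\<exists>H. simple_graph H \<and> connected_graph H \<and> verts H = {1..card (verts H)} \<and> graph_iso G H"
proof -
  let ?n = "card (verts G)"
  have fin: "finite (verts G)" and sub: "\<And>e. e \<in> edges G \<Longrightarrow> e \<subseteq> verts G \<and> card e = 2"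
    using G(1) by (auto simp: simple_graph_def)
  obtain f where f: "bij_betw f (verts G) {1..?n}"
    using finite_same_card_bij[OF fin, of "{1..?n}"] by auto
  then have inj: "inj_on f (verts G)" and im: "f ` verts G = {1..?n}"
    by (auto simp: bij_betw_def)
  define H :: graph where "H = ({1..?n}, (`) f ` edges G)"
  have vH: "verts H = {1..?n}" and eH: "edges H = (`) f ` edges G" by (simp_all add: H_def)
  have "f ` e \<subseteq> verts H \<and> card (f ` e) = 2" if "e \<in> edges G" for e
  proof -
    have "inj_on f e" using inj sub[OF that] inj_on_subset by blast
    then show ?thesis using sub[OF that] im vH by (metis card_image image_mono)
  qed
  then have simple: "simple_graph H" by (auto simp: simple_graph_def vH eH)
  have step: "(f u, f v) \<in> (adj H)\<^sup>*" if "(u, v) \<in> (adj G)\<^sup>*" for u v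
    using that
  proof (induction rule: rtrancl_induct)
    case base then show ?case by simp
  next
    case (step y z)
    then have "{y, z} \<in> edges G" by (simp add: adj_def)
    then have "f ` {y, z} \<in> edges H" unfolding eH by (rule imageI)
    then have "(f y, f z) \<in> adj H" by (simp add: adj_def)
    then show ?case using step.IH by simp
  qed
  have conn: "connected_graph H"
    unfolding connected_graph_def vH im[symmetric]
    using G(2) step by (auto simp: connected_graph_def)
  have "{u, v} \<in> edges G \<longleftrightarrow> {f u, f v} \<in> edges H" if "u \<in> verts G" "v \<in> verts G" for u v
  proof
    assume "{u, v} \<in> edges G"
    then have "f ` {u, v} \<in> edges H" unfolding eH by (rule imageI)
    then show "{f u, f v} \<in> edges H" by simp
  next
    assume "{f u, f v} \<in> edges H"
    then obtain e where e: "e \<in> edges G" "f ` {u, v} = f ` e" unfolding eH by auto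
    have "{u, v} = e"
      using inj_on_image_eq_iff[OF inj, of "{u, v}" e] e sub that by auto
    then show "{u, v} \<in> edges G" using e by simp
  qed
  then have "graph_iso G H" unfolding graph_iso_def using f vH by auto
  moreover have "verts H = {1..card (verts H)}" by (simp add: vH)
  ultimately show ?thesis using simple conn by blast
qed

lemma ex_community_graphs: "\<exists>\<H>. community_graphs \<H>"
proof -
  define L where "L H \<longleftrightarrow> simple_graph H \<and> connected_graph H \<and> verts H = {1..card (verts H)}" for H
  define r where "r G = (SOME H. L H \<and> graph_iso G H)" for G
  have ex: "\<exists>H. L H \<and> graph_iso G H" if "simple_graph G" "connected_graph G" for G
    using ex_labelled_copy[OF that] unfolding L_def by blast
  have r: "L (r G) \<and> graph_iso G (r G)" if "simple_graph G" "connected_graph G" for G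
    unfolding r_def using ex[OF that] by (rule someI_ex)
  have r_eq: "r G = r H" if "graph_iso G H" for G H
  proof -
    have "graph_iso G K \<longleftrightarrow> graph_iso H K" for K
      using that graph_iso_sym[OF that] graph_iso_trans by blast
    then show ?thesis by (simp add: r_def)
  qed
  let ?\<H> = "r ` {G. simple_graph G \<and> connected_graph G}"
  have "H = H'" if mem: "H \<in> ?\<H>" "H' \<in> ?\<H>" and iso: "graph_iso H H'" for H H'
  proof -
    obtain G G' where G: "H = r G" "H' = r G'" "simple_graph G" "connected_graph G"
      "simple_graph G'" "connected_graph G'" using mem by blast
    then have "graph_iso G H" "graph_iso H' G'" using r graph_iso_sym by blast+
    then have "graph_iso G G'" using iso graph_iso_trans by blast
    then show ?thesis using r_eq G(1,2) by simp
  qed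
  then have "\<forall>H\<in>?\<H>. \<forall>H'\<in>?\<H>. graph_iso H H' \<longrightarrow> H = H'" by blast
  moreover have "\<forall>H\<in>?\<H>. L H" using r by blast
  moreover have "\<forall>G. simple_graph G \<and> connected_graph G \<longrightarrow> (\<exists>H\<in>?\<H>. graph_iso G H)"
    using r by blast
  ultimately have "community_graphs ?\<H>" unfolding community_graphs_def L_def by (intro conjI)
  then show ?thesis by (rule exI)
qed

definition representative :: "graph set \<Rightarrow> graph \<Rightarrow> graph" where
  "representative \<H> G = (THE H. H \<in> \<H> \<and> graph_iso G H)"

definition component_verts :: "graph \<Rightarrow> nat \<Rightarrow> nat set" where
  "component_verts G v = {w \<in> verts G. (v, w) \<in> (adj G)\<^sup>*}"

definition component :: "graph \<Rightarrow> nat \<Rightarrow> graph" where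
  "component G v = (component_verts G v, {e \<in> edges G. e \<subseteq> component_verts G v})"

text \<open>Every connected component is listed once, through its least vertex.\<close>

definition component_list :: "graph \<Rightarrow> graph list" where
  "component_list G =
     map (component G) (filter (\<lambda>v. v = Min (component_verts G v)) (sorted_list_of_set (verts G)))"


section \<open>The random intersection graph with communities\<close>

text \<open>\<open>(v, i)\<close> is the \<open>i\<close>-th half-edge of the individual \<open>v\<close>.\<close>

definition half_edges :: "nat \<Rightarrow> (nat \<Rightarrow> nat) \<Rightarrow> (nat \<times> nat) set" where
  "half_edges N d = (SIGMA v:{1..N}. {1..d v})"

definition com_verts :: "graph list \<Rightarrow> (nat \<times> nat) set" where
  "com_verts Com = (SIGMA a:{..<length Com}. verts (Com ! a))"

definition com_edges :: "graph list \<Rightarrow> (nat \<times> nat set) set" where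
  "com_edges Com = (SIGMA a:{..<length Com}. edges (Com ! a))"

definition matchings :: "nat \<Rightarrow> (nat \<Rightarrow> nat) \<Rightarrow> graph list \<Rightarrow> (nat \<times> nat \<Rightarrow> nat \<times> nat) set" where
  "matchings N d Com =
     {\<omega> \<in> extensional (half_edges N d). bij_betw \<omega> (half_edges N d) (com_verts Com)}"

definition matched ::
  "nat \<Rightarrow> (nat \<Rightarrow> nat) \<Rightarrow> (nat \<times> nat \<Rightarrow> nat \<times> nat) \<Rightarrow> nat \<Rightarrow> nat \<times> nat \<Rightarrow> bool" where
  "matched N d \<omega> v j \<longleftrightarrow> (\<exists>i. (v, i) \<in> half_edges N d \<and> \<omega> (v, i) = j)"

text \<open>A multigraph on \<open>{1..N}\<close> is its (symmetric) function of edge multiplicities, which vanishes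
  off \<open>{1..N}\<close>; the diagonal entry at \<open>v\<close> is the number of self-loops at \<open>v\<close>, each counted once.\<close>

type_synonym multigraph = "nat \<Rightarrow> nat \<Rightarrow> nat"

definition rigc_mult ::
  "nat \<Rightarrow> (nat \<Rightarrow> nat) \<Rightarrow> graph list \<Rightarrow> (nat \<times> nat \<Rightarrow> nat \<times> nat) \<Rightarrow> multigraph" where
  "rigc_mult N d Com \<omega> = (\<lambda>v w. \<Sum>(a, e)\<in>com_edges Com.
     of_bool (\<exists>j1 j2. e = {j1, j2} \<and>
       (matched N d \<omega> v (a, j1) \<and> matched N d \<omega> w (a, j2) \<or>
        matched N d \<omega> v (a, j2) \<and> matched N d \<omega> w (a, j1))))"

definition RIGC :: "nat \<Rightarrow> (nat \<Rightarrow> nat) \<Rightarrow> graph list \<Rightarrow> multigraph pmf" where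
  "RIGC N d Com = map_pmf (rigc_mult N d Com) (pmf_of_set (matchings N d Com))"


section \<open>Percolation\<close>

text \<open>\<open>({v, w}, k)\<close> with \<open>k < X v w\<close> is the \<open>k\<close>-th parallel copy of the edge between \<open>v\<close> and \<open>w\<close>.
  The unordered pair makes both orientations refer to the same copy.\<close>

definition edge_copies :: "nat \<Rightarrow> multigraph \<Rightarrow> (nat set \<times> nat) set" where
  "edge_copies N X = {({v, w}, k) | v w k. v \<in> {1..N} \<and> w \<in> {1..N} \<and> k < X v w}"

definition percolate_multigraph :: "real \<Rightarrow> nat \<Rightarrow> multigraph \<Rightarrow> multigraph pmf" where
  "percolate_multigraph p N X =
     map_pmf (\<lambda>R v w. card {k. ({v, w}, k) \<in> edge_copies N X \<and> R ({v, w}, k)})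
       (Pi_pmf (edge_copies N X) False (\<lambda>_. bernoulli_pmf p))"

definition retained_com :: "graph list \<Rightarrow> (nat \<times> nat set \<Rightarrow> bool) \<Rightarrow> nat \<Rightarrow> graph" where
  "retained_com Com R a = (verts (Com ! a), {e \<in> edges (Com ! a). R (a, e)})"

definition percolate_com :: "graph set \<Rightarrow> real \<Rightarrow> graph list \<Rightarrow> graph list pmf" where
  "percolate_com \<H> p Com =
     map_pmf
       (\<lambda>R. concat (map (\<lambda>a. map (representative \<H>) (component_list (retained_com Com R a)))
                        [0..<length Com]))
       (Pi_pmf (com_edges Com) False (\<lambda>_. bernoulli_pmf p))"

end

theory Submission imports Defs
begin

text \<open>
  Fix a matching \<open>\<omega>\<close>. It sends every community edge to a pair of individuals, and the copies of the
  multi-edge between \<open>v\<close> and \<open>w\<close> are in bijection with the community edges sent to \<open>{v, w}\<close>. The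
  retention indicators are independent and identically distributed, so they can be attached to the
  community edges instead of the copies: percolating the multigraph obtained from \<open>\<omega>\<close> has the same
  law as applying \<open>\<omega>\<close> to the communities after deleting some of their edges
  (\<open>percolate_rigc_mult\<close>). Deleting edges leaves the community vertices alone and hence
  also the set of matchings. The retained edge set and the matching can therefore be sampled
  in either order.

  It remains to compare, for a fixed retained edge set, the list of possibly disconnected retained
  communities with the list of canonical copies of their connected components. Only the disjoint
  union of the communities enters the construction of the multigraph: an isomorphism between the
  disjoint unions of two lists carries the uniform matching of one to the uniform matching of the
  other without changing the owners of the endpoints of an edge (\<open>RIGC_union_iso\<close>). Splitting a graph into
  components and relabelling each component are isomorphisms of this kind, and such isomorphisms
  can be glued along concatenation of lists (\<open>union_iso_concat\<close>).
\<close>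

section \<open>The endpoints of a community edge under a matching\<close>

abbreviation simple_graphs :: "graph list \<Rightarrow> bool" where
  "simple_graphs C \<equiv> \<forall>G\<in>set C. simple_graph G"

lemma simple_graph_edge_cases:
  assumes "simple_graph G" "e \<in> edges G"
  obtains u v where "e = {u, v}" "u \<noteq> v" "u \<in> verts G" "v \<in> verts G"
  using assms unfolding simple_graph_def by (metis card_2_iff insert_subset)

lemma com_edges_cases:
  assumes "simple_graphs C" "(a, e) \<in> com_edges C"
  obtains u v where "e = {u, v}" "u \<noteq> v" "(a, u) \<in> com_verts C" "(a, v) \<in> com_verts C"
proof -
  have a: "a < length C" "e \<in> edges (C ! a)" using assms(2) by (auto simp: com_edges_def)
  then have "simple_graph (C ! a)" using assms(1) by simp
  then obtain u v where "e = {u, v}" "u \<noteq> v" "u \<in> verts (C ! a)" "v \<in> verts (C ! a)"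
    using a(2) by (rule simple_graph_edge_cases)
  then show thesis using a(1) that by (auto simp: com_verts_def)
qed

lemma finite_com_verts: "simple_graphs C \<Longrightarrow> finite (com_verts C)"
  unfolding com_verts_def simple_graph_def by (intro finite_SigmaI) auto

lemma finite_com_edges: "simple_graphs C \<Longrightarrow> finite (com_edges C)"
proof -
  assume C: "simple_graphs C"
  have "finite (edges (C ! a))" if "a < length C" for a
  proof (rule finite_subset)
    show "edges (C ! a) \<subseteq> Pow (verts (C ! a))"
      using C[rule_format, OF nth_mem[OF that]] unfolding simple_graph_def by blast
    show "finite (Pow (verts (C ! a)))" using C that by (simp add: simple_graph_def)
  qed
  then show ?thesis unfolding com_edges_def by (intro finite_SigmaI) auto
qed

text \<open>If \<open>\<omega>\<close> is a matching, then for \<open>j\<close> among the community vertices this is the unique \<open>v\<close> with \<open>matched N d \<omega> v j\<close>.\<close>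

definition owner :: "nat \<Rightarrow> (nat \<Rightarrow> nat) \<Rightarrow> (nat \<times> nat \<Rightarrow> nat \<times> nat) \<Rightarrow> nat \<times> nat \<Rightarrow> nat" where
  "owner N d \<omega> j = fst (inv_into (half_edges N d) \<omega> j)"

definition ends ::
  "nat \<Rightarrow> (nat \<Rightarrow> nat) \<Rightarrow> (nat \<times> nat \<Rightarrow> nat \<times> nat) \<Rightarrow> nat \<times> nat set \<Rightarrow> nat set" where
  "ends N d \<omega> = (\<lambda>(a, e). owner N d \<omega> ` Pair a ` e)"

lemma owner_eq:
  assumes "inj_on \<omega> (half_edges N d)" "h \<in> half_edges N d"
  shows "owner N d \<omega> (\<omega> h) = fst h"
  using assms by (simp add: owner_def)

lemma matchings_imageE:
  assumes "\<omega> \<in> matchings N d C" "j \<in> com_verts C"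
  obtains h where "h \<in> half_edges N d" "\<omega> h = j"
proof -
  have "j \<in> \<omega> ` half_edges N d" using assms by (simp add: matchings_def bij_betw_def)
  then show thesis using that by blast
qed

lemma inj_on_matching: "\<omega> \<in> matchings N d C \<Longrightarrow> inj_on \<omega> (half_edges N d)"
  by (auto simp: matchings_def bij_betw_def)

lemma matched_iff_owner:
  assumes "\<omega> \<in> matchings N d C" "j \<in> com_verts C"
  shows "matched N d \<omega> v j \<longleftrightarrow> owner N d \<omega> j = v"
proof -
  obtain h where h: "h \<in> half_edges N d" "\<omega> h = j" using assms by (rule matchings_imageE)
  note inj = inj_on_matching[OF assms(1)]
  show ?thesis
    using h owner_eq[OF inj] unfolding matched_def by (metis fst_conv prod.collapse)
qed

lemma owner_in_range:
  assumes "\<omega> \<in> matchings N d C" "j \<in> com_verts C"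
  shows "owner N d \<omega> j \<in> {1..N}"
proof -
  obtain h where h: "h \<in> half_edges N d" "\<omega> h = j" using assms by (rule matchings_imageE)
  then show ?thesis
    using owner_eq[OF inj_on_matching[OF assms(1)] h(1)] by (auto simp: half_edges_def)
qed

lemma ends_in_range:
  assumes "\<omega> \<in> matchings N d C" "simple_graphs C" "x \<in> com_edges C"
  shows "\<exists>v\<in>{1..N}. \<exists>w\<in>{1..N}. ends N d \<omega> x = {v, w}"
proof -
  obtain a e where x: "x = (a, e)" by force
  obtain j1 j2 where "e = {j1, j2}" "(a, j1) \<in> com_verts C" "(a, j2) \<in> com_verts C"
    using com_edges_cases[OF assms(2) assms(3)[unfolded x]] by metis
  then have "ends N d \<omega> x = {owner N d \<omega> (a, j1), owner N d \<omega> (a, j2)}"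
    "owner N d \<omega> (a, j1) \<in> {1..N}" "owner N d \<omega> (a, j2) \<in> {1..N}"
    using owner_in_range[OF assms(1)] by (simp_all add: x ends_def)
  then show ?thesis by (intro bexI)
qed

text \<open>Each community vertex has exactly one owner, so the two orientations in the indicator
  collapse to an equality of unordered pairs. For a loop the pair \<open>{v, v}\<close> is a singleton, which
  agrees with the convention of counting a loop once.\<close>

lemma rigc_mult_eq_card:
  assumes \<omega>: "\<omega> \<in> matchings N d C" and C: "simple_graphs C"
  shows "rigc_mult N d C \<omega> v w = card {x \<in> com_edges C. ends N d \<omega> x = {v, w}}"
proof -
  let ?P = "\<lambda>a e. \<exists>j1 j2. e = {j1, j2} \<and>
       (matched N d \<omega> v (a, j1) \<and> matched N d \<omega> w (a, j2) \<or>
        matched N d \<omega> v (a, j2) \<and> matched N d \<omega> w (a, j1))"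
  have iff: "?P a e \<longleftrightarrow> ends N d \<omega> (a, e) = {v, w}" if x: "(a, e) \<in> com_edges C" for a e
  proof -
    obtain u u' where e: "e = {u, u'}" and u: "(a, u) \<in> com_verts C" "(a, u') \<in> com_verts C"
      using com_edges_cases[OF C x] by metis
    have "?P a e \<longleftrightarrow> matched N d \<omega> v (a, u) \<and> matched N d \<omega> w (a, u') \<or>
        matched N d \<omega> v (a, u') \<and> matched N d \<omega> w (a, u)"
      unfolding e doubleton_eq_iff by blast
    then show ?thesis
      by (auto simp: matched_iff_owner[OF \<omega>] u ends_def e doubleton_eq_iff)
  qed
  have "rigc_mult N d C \<omega> v w = (\<Sum>x\<in>com_edges C. of_bool (ends N d \<omega> x = {v, w}))"
    unfolding rigc_mult_def
  proof (intro sum.cong refl)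
    fix x assume "x \<in> com_edges C"
    then show "(case x of (a, e) \<Rightarrow> of_bool (?P a e)) = (of_bool (ends N d \<omega> x = {v, w}) :: nat)"
      by (cases x) (simp only: case_prod_conv iff)
  qed
  also have "\<dots> = card (com_edges C \<inter> {x. ends N d \<omega> x = {v, w}})"
    using finite_com_edges[OF C] by (simp add: sum_of_bool_eq)
  finally show ?thesis by (simp add: Int_def)
qed


section \<open>Percolation of a multigraph\<close>

text \<open>If the multiplicities of \<open>X\<close> are the fibre sizes of a map \<open>f\<close> into unordered pairs, then
  numbering every fibre gives a bijection from the domain of \<open>f\<close> to the edge copies which lies
  over the identity on pairs. Transporting the independent coins along it turns the count of
  retained copies into the count of retained elements of the fibre.\<close>

lemma percolate_multigraph_fibre_counts:
  assumes A: "finite A" and f: "\<And>x. x \<in> A \<Longrightarrow> \<exists>v\<in>{1..N}. \<exists>w\<in>{1..N}. f x = {v, w}"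
    and X: "\<And>v w. X v w = card {x \<in> A. f x = {v, w}}"
  shows "percolate_multigraph p N X =
    map_pmf (\<lambda>R v w. card {x \<in> A. f x = {v, w} \<and> R x}) (Pi_pmf A False (\<lambda>_. bernoulli_pmf p))"
proof -
  have "\<exists>g. bij_betw g {x \<in> A. f x = s} {..<card {x \<in> A. f x = s}}" for s
    using ex_bij_betw_finite_nat[of "{x \<in> A. f x = s}"] A by (simp add: atLeast0LessThan)
  then obtain g where g: "\<And>s. bij_betw (g s) {x \<in> A. f x = s} {..<card {x \<in> A. f x = s}}"
    by metis
  \<comment> \<open>Off \<open>A\<close> the value only has to miss the edge copies, and no edge has an empty endpoint set.\<close>
  define h where "h x = (if x \<in> A then (f x, g (f x) x) else ({}, 0))" for x
  let ?B = "edge_copies N X"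
  have copies: "(s, k) \<in> ?B \<longleftrightarrow> k < card {x \<in> A. f x = s}" for s k
  proof
    assume "(s, k) \<in> ?B" then show "k < card {x \<in> A. f x = s}"
      by (auto simp: edge_copies_def X)
  next
    assume k: "k < card {x \<in> A. f x = s}"
    then have "{x \<in> A. f x = s} \<noteq> {}" by (metis card.empty not_less_zero)
    then obtain v w where "v \<in> {1..N}" "w \<in> {1..N}" "s = {v, w}" using f by blast
    then show "(s, k) \<in> ?B" using k unfolding edge_copies_def X by blast
  qed
  \<comment> \<open>One bijection per pair and predicate: with \<open>Q\<close> the retention predicate it compares the counts,
    with \<open>Q\<close> true it shows that \<open>h\<close> is a bijection.\<close>
  have h: "bij_betw h {x \<in> A. f x = s \<and> Q (h x)} {(s, k) | k. (s, k) \<in> ?B \<and> Q (s, k)}" for s Q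
    unfolding copies
  proof (rule bij_betw_imageI)
    show "inj_on h {x \<in> A. f x = s \<and> Q (h x)}"
      using g[of s] by (auto simp: inj_on_def h_def bij_betw_def)
    have "{..<card {x \<in> A. f x = s}} = g s ` {x \<in> A. f x = s}"
      using g[of s] by (simp add: bij_betw_def)
    then have "k \<in> {..<card {x \<in> A. f x = s}} \<longleftrightarrow> (\<exists>x\<in>A. f x = s \<and> g s x = k)" for k
      by (auto simp only: image_iff mem_Collect_eq)
    then have "k < card {x \<in> A. f x = s} \<longleftrightarrow> (\<exists>x\<in>A. f x = s \<and> g s x = k)" for k
      by (simp only: lessThan_iff)
    then show "h ` {x \<in> A. f x = s \<and> Q (h x)} = {(s, k) |k. k < card {x \<in> A. f x = s} \<and> Q (s, k)}"
      by (auto simp: h_def image_iff)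
  qed
  have count: "card {k. (s, k) \<in> ?B \<and> R (s, k)} = card {x \<in> A. f x = s \<and> R (h x)}" for s R
  proof -
    have "card {k. (s, k) \<in> ?B \<and> R (s, k)} = card (Pair s ` {k. (s, k) \<in> ?B \<and> R (s, k)})"
      by (rule card_image[symmetric]) (simp add: inj_on_def)
    also have "Pair s ` {k. (s, k) \<in> ?B \<and> R (s, k)} = {(s, k) | k. (s, k) \<in> ?B \<and> R (s, k)}"
      by auto
    also have "card \<dots> = card {x \<in> A. f x = s \<and> R (h x)}"
      using bij_betw_same_card[OF h] by metis
    finally show ?thesis .
  qed
  have bij: "bij_betw h A ?B"
  proof (rule bij_betw_imageI)
    have "fst (h x) = f x" if "x \<in> A" for x using that by (simp add: h_def)
    moreover have "inj_on h {x \<in> A. f x = s}" for s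
      using h[of s "\<lambda>_. True"] by (simp add: bij_betw_def)
    ultimately show "inj_on h A"
      unfolding inj_on_def by (metis (mono_tags, lifting) mem_Collect_eq)
    have "?B = (\<Union>s. {(s, k) | k. (s, k) \<in> ?B \<and> True})" by auto
    also have "\<dots> = (\<Union>s. h ` {x \<in> A. f x = s \<and> True})"
      using h[of _ "\<lambda>_. True"] by (simp add: bij_betw_def)
    finally show "h ` A = ?B" by auto
  qed
  have out: "h x \<notin> ?B" if "x \<notin> A" for x
    using that by (auto simp: h_def edge_copies_def)
  have "Pi_pmf A False (\<lambda>_. bernoulli_pmf p) =
      map_pmf (\<lambda>R. R \<circ> h) (Pi_pmf ?B False (\<lambda>_. bernoulli_pmf p))"
    using Pi_pmf_bij_betw[OF A bij out] by simp
  then show ?thesis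
    by (simp add: percolate_multigraph_def map_pmf_comp count)
qed

definition retained_list :: "graph list \<Rightarrow> (nat \<times> nat set \<Rightarrow> bool) \<Rightarrow> graph list" where
  "retained_list C R = map (retained_com C R) [0..<length C]"

lemma simple_retained: "simple_graphs C \<Longrightarrow> simple_graphs (retained_list C R)"
  by (auto simp: retained_list_def retained_com_def simple_graph_def)

lemma com_verts_retained: "com_verts (retained_list C R) = com_verts C"
  by (auto simp: com_verts_def retained_list_def retained_com_def)

lemma com_edges_retained: "com_edges (retained_list C R) = {x \<in> com_edges C. R x}"
  by (auto simp: com_edges_def retained_list_def retained_com_def)

lemma matchings_retained: "matchings N d (retained_list C R) = matchings N d C"
  by (simp add: matchings_def com_verts_retained)

text \<open>Conditionally on the matching, percolation commutes with the construction of the multigraph: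
  the map to be fed into \<open>percolate_multigraph_fibre_counts\<close> sends a community edge to the owners
  of its endpoints, and it is unaffected by the deletion of other community edges.\<close>

lemma percolate_rigc_mult:
  assumes \<omega>: "\<omega> \<in> matchings N d C" and C: "simple_graphs C"
  shows "percolate_multigraph p N (rigc_mult N d C \<omega>) =
    map_pmf (\<lambda>R. rigc_mult N d (retained_list C R) \<omega>)
      (Pi_pmf (com_edges C) False (\<lambda>_. bernoulli_pmf p))"
proof -
  have "rigc_mult N d (retained_list C R) \<omega> v w =
      card {x \<in> com_edges C. ends N d \<omega> x = {v, w} \<and> R x}" for R v w
    using rigc_mult_eq_card[of \<omega> N d "retained_list C R"] \<omega> simple_retained[OF C]
    by (simp add: matchings_retained com_edges_retained conj_ac)
  then show ?thesis
    using percolate_multigraph_fibre_counts[OF finite_com_edges[OF C] ends_in_range[OF \<omega> C]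
        rigc_mult_eq_card[OF \<omega> C]]
    by presburger
qed


section \<open>Invariance under isomorphism of disjoint unions\<close>

text \<open>An edge is encoded as a set of vertices of the disjoint union, so that an isomorphism acts on it
  by taking images, even if the isomorphism splits or merges entries of the list.\<close>

definition union_edges :: "graph list \<Rightarrow> (nat \<times> nat) set set" where
  "union_edges C = (\<lambda>(a, e). Pair a ` e) ` com_edges C"

definition union_iso :: "graph list \<Rightarrow> graph list \<Rightarrow> bool" where
  "union_iso C C' \<longleftrightarrow> (\<exists>\<phi>. bij_betw \<phi> (com_verts C) (com_verts C') \<and>
     union_edges C' = (`) \<phi> ` union_edges C)"

lemma union_isoI:
  "bij_betw \<phi> (com_verts C) (com_verts C') \<Longrightarrow> union_edges C' = (`) \<phi> ` union_edges C \<Longrightarrow> union_iso C C'"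
  unfolding union_iso_def by (intro exI conjI)

lemma union_isoE:
  assumes "union_iso C C'"
  obtains \<phi> where "bij_betw \<phi> (com_verts C) (com_verts C')" "union_edges C' = (`) \<phi> ` union_edges C"
  using assms unfolding union_iso_def by (elim exE conjE)

lemma union_edges_subset:
  assumes "simple_graphs C" "E \<in> union_edges C"
  shows "E \<subseteq> com_verts C"
  using assms(2) unfolding union_edges_def
  by (auto elim!: com_edges_cases[OF assms(1)])

text \<open>An edge is nonempty, so it remembers its community index as a set of pairs.\<close>

lemma card_ends_eq_card_union_edges:
  assumes "simple_graphs C"
  shows "card {x \<in> com_edges C. ends N d \<omega> x = s} = card {E \<in> union_edges C. owner N d \<omega> ` E = s}"
proof (rule bij_betw_same_card[OF bij_betw_imageI])
  let ?g = "\<lambda>(a, e). Pair a ` e"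
  show "inj_on ?g {x \<in> com_edges C. ends N d \<omega> x = s}"
  proof (rule inj_onI, clarify)
    fix a e b e' assume eq: "Pair a ` e = Pair b ` e'" and x: "(a, e) \<in> com_edges C"
    obtain u where "u \<in> e" using com_edges_cases[OF assms x] by blast
    then have "a = b" using eq by auto
    moreover have "e = snd ` Pair a ` e" "e' = snd ` Pair b ` e'" by force+
    ultimately show "a = b \<and> e = e'" using eq by simp
  qed
  show "?g ` {x \<in> com_edges C. ends N d \<omega> x = s} = {E \<in> union_edges C. owner N d \<omega> ` E = s}"
    by (force simp: union_edges_def ends_def)
qed

text \<open>Equality of the two vertex counts makes the uniform distribution on matchings meaningful;
  on an empty or infinite set \<^const>\<open>pmf_of_set\<close> is unspecified.\<close>

lemma matchings_nonempty_finite: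
  assumes C: "simple_graphs C"
    and sum: "(\<Sum>v\<in>{1..N}. d v) = (\<Sum>a<length C. card (verts (C ! a)))"
  shows "matchings N d C \<noteq> {}" "finite (matchings N d C)"
proof -
  have fin: "finite (half_edges N d)" by (simp add: half_edges_def)
  have "card (half_edges N d) = card (com_verts C)"
    using sum C by (simp add: half_edges_def com_verts_def simple_graph_def)
  then obtain f where f: "bij_betw f (half_edges N d) (com_verts C)"
    using finite_same_card_bij[OF fin finite_com_verts[OF C]] by blast
  have "restrict f (half_edges N d) \<in> matchings N d C"
    using f by (auto simp: matchings_def cong: bij_betw_cong)
  then show "matchings N d C \<noteq> {}" by blast
  have "matchings N d C \<subseteq> half_edges N d \<rightarrow>\<^sub>E com_verts C"
    by (auto simp: matchings_def bij_betw_def PiE_def)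
  then show "finite (matchings N d C)"
    by (rule finite_subset) (intro finite_PiE fin finite_com_verts[OF C])
qed

lemma bij_betw_matchings:
  assumes \<phi>: "bij_betw \<phi> (com_verts C) (com_verts C')"
  shows "bij_betw (\<lambda>\<omega>. restrict (\<phi> \<circ> \<omega>) (half_edges N d)) (matchings N d C) (matchings N d C')"
proof -
  let ?H = "half_edges N d"
  define \<psi> where "\<psi> = inv_into (com_verts C) \<phi>"
  have \<psi>: "bij_betw \<psi> (com_verts C') (com_verts C)" unfolding \<psi>_def using \<phi> by (rule bij_betw_inv_into)
  have maps: "restrict (\<theta> \<circ> \<omega>) ?H \<in> matchings N d D'"
    if "bij_betw \<theta> (com_verts D) (com_verts D')" "\<omega> \<in> matchings N d D" for \<theta> \<omega> D D'
    using bij_betw_trans[OF _ that(1), of \<omega> ?H] that(2)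
    by (auto simp: matchings_def cong: bij_betw_cong)
  have cancel: "restrict (\<theta>' \<circ> restrict (\<theta> \<circ> \<omega>) ?H) ?H = \<omega>"
    if "\<And>j. j \<in> com_verts D \<Longrightarrow> \<theta>' (\<theta> j) = j" "\<omega> \<in> matchings N d D" for \<theta> \<theta>' \<omega> D
  proof (rule extensionalityI)
    show "\<omega> \<in> extensional ?H" using that(2) by (simp add: matchings_def)
    fix h assume h: "h \<in> ?H"
    then have "\<omega> h \<in> com_verts D" using that(2) by (auto simp: matchings_def dest: bij_betwE)
    then show "restrict (\<theta>' \<circ> restrict (\<theta> \<circ> \<omega>) ?H) ?H h = \<omega> h"
      using that(1) h by simp
  qed simp
  show ?thesis
  proof (rule bij_betw_byWitness[where f' = "\<lambda>\<omega>. restrict (\<psi> \<circ> \<omega>) ?H"])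
    show "\<forall>\<omega>\<in>matchings N d C. restrict (\<psi> \<circ> restrict (\<phi> \<circ> \<omega>) ?H) ?H = \<omega>"
      using cancel[of C \<psi> \<phi>] \<phi> by (simp add: \<psi>_def bij_betw_inv_into_left)
    show "\<forall>\<omega>\<in>matchings N d C'. restrict (\<phi> \<circ> restrict (\<psi> \<circ> \<omega>) ?H) ?H = \<omega>"
      using cancel[of C' \<phi> \<psi>] \<phi> by (simp add: \<psi>_def bij_betw_inv_into_right)
  qed (use maps[OF \<phi>] maps[OF \<psi>] in auto)
qed

lemma rigc_mult_union_iso:
  assumes \<omega>: "\<omega> \<in> matchings N d C" and C: "simple_graphs C" "simple_graphs C'"
    and \<phi>: "bij_betw \<phi> (com_verts C) (com_verts C')" "union_edges C' = (`) \<phi> ` union_edges C"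
  shows "rigc_mult N d C' (restrict (\<phi> \<circ> \<omega>) (half_edges N d)) = rigc_mult N d C \<omega>"
proof (intro ext)
  fix v w
  let ?\<omega>' = "restrict (\<phi> \<circ> \<omega>) (half_edges N d)"
  have \<omega>': "?\<omega>' \<in> matchings N d C'"
    using bij_betw_matchings[OF \<phi>(1)] \<omega> by (auto simp: bij_betw_def)
  have own: "owner N d ?\<omega>' (\<phi> j) = owner N d \<omega> j" if j: "j \<in> com_verts C" for j
  proof -
    obtain h where h: "h \<in> half_edges N d" "\<omega> h = j" using \<omega> j by (rule matchings_imageE)
    then show ?thesis
      using owner_eq[OF inj_on_matching[OF \<omega>'] h(1)] owner_eq[OF inj_on_matching[OF \<omega>] h(1)]
      by simp
  qed
  have img: "owner N d ?\<omega>' ` \<phi> ` E = owner N d \<omega> ` E" if "E \<in> union_edges C" for E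
    using own union_edges_subset[OF C(1) that] by (force simp: image_image)
  have inj: "inj_on ((`) \<phi>) (union_edges C)"
    using \<phi>(1) union_edges_subset[OF C(1)]
    by (metis (no_types, lifting) bij_betw_def inj_onI inj_on_image_eq_iff)
  have "{E \<in> union_edges C'. owner N d ?\<omega>' ` E = {v, w}} =
      (`) \<phi> ` {E \<in> union_edges C. owner N d \<omega> ` E = {v, w}}"
    unfolding \<phi>(2) using img by auto
  then have "card {E \<in> union_edges C'. owner N d ?\<omega>' ` E = {v, w}} =
      card {E \<in> union_edges C. owner N d \<omega> ` E = {v, w}}"
    using card_image[OF inj_on_subset[OF inj]] by simp
  then show "rigc_mult N d C' ?\<omega>' v w = rigc_mult N d C \<omega> v w"
    by (simp add: rigc_mult_eq_card \<omega> \<omega>' C card_ends_eq_card_union_edges)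
qed

text \<open>Composition with the isomorphism \<open>\<phi>\<close> is a bijection between the two sets of matchings, hence
  maps one uniform distribution to the other. The half-edge matched to \<open>j\<close> before is the one matched to
  \<open>\<phi> j\<close> afterwards, so the multigraph is unchanged.\<close>

lemma RIGC_union_iso:
  assumes C: "simple_graphs C" "simple_graphs C'" and iso: "union_iso C C'"
    and ne: "matchings N d C' \<noteq> {}" "finite (matchings N d C')"
  shows "RIGC N d C = RIGC N d C'"
proof -
  obtain \<phi> where \<phi>: "bij_betw \<phi> (com_verts C) (com_verts C')"
    "union_edges C' = (`) \<phi> ` union_edges C"
    using iso by (rule union_isoE)
  let ?g = "\<lambda>\<omega>. restrict (\<phi> \<circ> \<omega>) (half_edges N d)"
  have bij: "bij_betw ?g (matchings N d C) (matchings N d C')"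
    using \<phi>(1) by (rule bij_betw_matchings)
  then have ne': "matchings N d C \<noteq> {}" "finite (matchings N d C)"
    using ne bij_betw_finite[OF bij] by (auto simp: bij_betw_def)
  have "pmf_of_set (matchings N d C') = map_pmf ?g (pmf_of_set (matchings N d C))"
    using map_pmf_of_set_bij_betw[OF bij ne'] by simp
  then have "RIGC N d C' = map_pmf (\<lambda>\<omega>. rigc_mult N d C' (?g \<omega>)) (pmf_of_set (matchings N d C))"
    by (simp add: RIGC_def map_pmf_comp)
  also have "\<dots> = RIGC N d C"
    unfolding RIGC_def
    by (intro map_pmf_cong refl rigc_mult_union_iso C \<phi>) (simp add: ne')
  finally show ?thesis by simp
qed

lemma union_iso_trans:
  assumes "union_iso C C'" "union_iso C' C''"
  shows "union_iso C C''"
proof -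
  obtain \<phi> where \<phi>: "bij_betw \<phi> (com_verts C) (com_verts C')"
      "union_edges C' = (`) \<phi> ` union_edges C"
    using assms(1) by (rule union_isoE)
  obtain \<psi> where \<psi>: "bij_betw \<psi> (com_verts C') (com_verts C'')"
      "union_edges C'' = (`) \<psi> ` union_edges C'"
    using assms(2) by (rule union_isoE)
  show ?thesis
  proof (rule union_isoI)
    show "bij_betw (\<psi> \<circ> \<phi>) (com_verts C) (com_verts C'')"
      using \<phi>(1) \<psi>(1) by (rule bij_betw_trans)
    show "union_edges C'' = (`) (\<psi> \<circ> \<phi>) ` union_edges C"
      unfolding \<phi>(2) \<psi>(2) image_image comp_def ..
  qed
qed

lemma com_verts_UN: "com_verts C = (\<Union>a<length C. Pair a ` verts (C ! a))"
  by (auto simp: com_verts_def)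

lemma union_edges_UN: "union_edges C = (\<Union>a<length C. (`) (Pair a) ` edges (C ! a))"
  by (force simp: union_edges_def com_edges_def)

lemma lessThan_length_append:
  "{..<length (C @ D)} = {..<length C} \<union> (+) (length C) ` {..<length D}"
proof -
  have "i \<in> (+) (length C) ` {..<length D}" if "i < length C + length D" "\<not> i < length C" for i
    by (rule image_eqI[where x = "i - length C"]) (use that in auto)
  then show ?thesis by auto
qed

text \<open>Both vertices and edges of a disjoint union are unions over the positions of the list. In an
  appended list the positions of the second part are shifted by the length of the first.\<close>

lemma UN_nth_append:
  "(\<Union>a<length (C @ D). F a ((C @ D) ! a)) =
    (\<Union>a<length C. F a (C ! a)) \<union> (\<Union>a<length D. F (length C + a) (D ! a))"
proof -
  have "(\<Union>a<length C. F a ((C @ D) ! a)) = (\<Union>a<length C. F a (C ! a))"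
    by (intro SUP_cong refl) (simp add: nth_append)
  then show ?thesis unfolding lessThan_length_append UN_Un by simp
qed

lemma com_verts_append:
  "com_verts (C @ D) = com_verts C \<union> apfst ((+) (length C)) ` com_verts D"
  by (simp only: com_verts_UN UN_nth_append[where F = "\<lambda>a G. Pair a ` verts G"] image_UN image_image apfst_conv)

lemma union_edges_append:
  "union_edges (C @ D) = union_edges C \<union> (`) (apfst ((+) (length C))) ` union_edges D"
  by (simp only: union_edges_UN UN_nth_append[where F = "\<lambda>a G. (`) (Pair a) ` edges G"] image_UN
      image_image apfst_conv)

text \<open>The two isomorphisms are used on the two index ranges, after undoing and redoing the shifts of
  the second range, which differ because the lists may have different lengths.\<close>

lemma union_iso_append:
  assumes simple: "simple_graphs C" "simple_graphs D"
    and iso: "union_iso C C'" "union_iso D D'"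
  shows "union_iso (C @ D) (C' @ D')"
proof -
  obtain \<phi> where \<phi>: "bij_betw \<phi> (com_verts C) (com_verts C')"
      "union_edges C' = (`) \<phi> ` union_edges C"
    using iso(1) by (rule union_isoE)
  obtain \<psi> where \<psi>: "bij_betw \<psi> (com_verts D) (com_verts D')"
      "union_edges D' = (`) \<psi> ` union_edges D"
    using iso(2) by (rule union_isoE)
  let ?s = "apfst ((+) (length C)) :: nat \<times> nat \<Rightarrow> _"
  let ?s' = "apfst ((+) (length C')) :: nat \<times> nat \<Rightarrow> _"
  define \<theta> where
    "\<theta> x = (if fst x < length C then \<phi> x else ?s' (\<psi> (fst x - length C, snd x)))" for x
  have left: "\<theta> x = \<phi> x" if "x \<in> com_verts C" for x
    using that by (auto simp: \<theta>_def com_verts_def)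
  have right: "\<theta> (?s x) = ?s' (\<psi> x)" for x
    by (simp add: \<theta>_def)
  have inj: "inj ?s'" by (auto simp: inj_def)
  have bij: "bij_betw \<theta> (com_verts C \<union> ?s ` com_verts D) (com_verts C' \<union> ?s' ` com_verts D')"
  proof (rule bij_betw_combine)
    show "bij_betw \<theta> (com_verts C) (com_verts C')"
      using \<phi>(1) left by (simp cong: bij_betw_cong)
    show "bij_betw \<theta> (?s ` com_verts D) (?s' ` com_verts D')"
    proof (rule bij_betw_imageI)
      have "inj_on (?s' \<circ> \<psi>) (com_verts D)"
        using \<psi>(1) inj by (intro comp_inj_on) (auto simp: bij_betw_def inj_on_def)
      moreover have "\<theta> \<circ> ?s = ?s' \<circ> \<psi>" using right by (simp add: fun_eq_iff)
      ultimately show "inj_on \<theta> (?s ` com_verts D)" by (metis inj_on_imageI)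
      have D': "com_verts D' = \<psi> ` com_verts D" using \<psi>(1) by (simp add: bij_betw_def)
      show "\<theta> ` ?s ` com_verts D = ?s' ` com_verts D'"
        unfolding D' image_image right ..
    qed
    show "com_verts C' \<inter> ?s' ` com_verts D' = {}" by (auto simp: com_verts_def)
  qed
  have edges: "(`) \<theta> ` (union_edges C \<union> (`) ?s ` union_edges D) =
      union_edges C' \<union> (`) ?s' ` union_edges D'"
  proof -
    have "\<theta> ` E = \<phi> ` E" if "E \<in> union_edges C" for E
      using left union_edges_subset[OF simple(1) that] by (auto intro!: image_cong)
    then have "(`) \<theta> ` union_edges C = union_edges C'" unfolding \<phi>(2) by (rule image_cong[OF refl])
    moreover have "(`) \<theta> ` (`) ?s ` union_edges D = (`) ?s' ` union_edges D'"
      unfolding \<psi>(2) by (simp add: image_image right)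
    ultimately show ?thesis by (simp add: image_Un)
  qed
  show ?thesis
    by (rule union_isoI[of \<theta>]) (simp_all only: com_verts_append union_edges_append bij edges)
qed

text \<open>Isomorphisms may be found community by community; \<open>g x\<close> is a list of pieces that replaces the
  single community \<open>f x\<close>.\<close>

lemma union_iso_concat:
  assumes "\<And>x. x \<in> set xs \<Longrightarrow> simple_graphs (g x) \<and> union_iso (g x) [f x]"
  shows "union_iso (concat (map g xs)) (map f xs)"
  using assms
proof (induction xs)
  case Nil
  then show ?case
    by (auto simp: union_iso_def com_verts_def union_edges_UN)
next
  case (Cons x xs)
  have "union_iso (g x @ concat (map g xs)) ([f x] @ map f xs)"
    by (rule union_iso_append) (use Cons in auto)
  then show ?case by simp
qed

lemma graph_iso_image:
  assumes "graph_iso G H" "simple_graph G" "simple_graph H"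
  shows "\<exists>f. bij_betw f (verts G) (verts H) \<and> edges H = (`) f ` edges G"
proof -
  obtain f where f: "bij_betw f (verts G) (verts H)"
    and e: "\<And>u v. u \<in> verts G \<Longrightarrow> v \<in> verts G \<Longrightarrow> {u, v} \<in> edges G \<longleftrightarrow> {f u, f v} \<in> edges H"
    using assms(1) unfolding graph_iso_def by blast
  have "edges H = (`) f ` edges G"
  proof (intro subset_antisym subsetI)
    fix E assume E: "E \<in> edges H"
    obtain x y where xy: "E = {x, y}" "x \<in> verts H" "y \<in> verts H"
      using simple_graph_edge_cases[OF assms(3) E] by metis
    obtain u v where uv: "u \<in> verts G" "v \<in> verts G" "x = f u" "y = f v"
      using xy(2,3) unfolding bij_betw_imp_surj_on[OF f, symmetric] by blast
    have "{u, v} \<in> edges G" "E = f ` {u, v}" using e[OF uv(1,2)] E uv(3,4) xy(1) by auto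
    then show "E \<in> (`) f ` edges G" by blast
  next
    fix E assume "E \<in> (`) f ` edges G"
    then obtain E' where E': "E' \<in> edges G" "E = f ` E'" by blast
    obtain u v where "E' = {u, v}" "u \<in> verts G" "v \<in> verts G"
      using simple_graph_edge_cases[OF assms(2) E'(1)] by metis
    then show "E \<in> edges H" using e[of u v] E' by simp
  qed
  then show ?thesis using f by blast
qed

lemma union_iso_pointwise:
  assumes iso: "\<And>K. K \<in> set Gs \<Longrightarrow> graph_iso (r K) K \<and> simple_graph (r K) \<and> simple_graph K"
  shows "union_iso (map r Gs) Gs"
proof -
  have single: "union_iso [H] [K]" if HK: "graph_iso H K" "simple_graph H" "simple_graph K" for H K
  proof -
    obtain f where f: "bij_betw f (verts H) (verts K)" "edges K = (`) f ` edges H"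
      using graph_iso_image[OF HK] by blast
    have "bij_betw (apsnd f) (Pair 0 ` verts H) (Pair (0::nat) ` verts K)"
    proof (rule bij_betw_imageI)
      show "inj_on (apsnd f) (Pair 0 ` verts H)"
        using f(1) by (auto simp: bij_betw_def inj_on_def)
      show "apsnd f ` Pair 0 ` verts H = Pair (0::nat) ` verts K"
        unfolding bij_betw_imp_surj_on[OF f(1), symmetric] by (simp add: image_image)
    qed
    moreover have "(`) (Pair 0) ` edges K = (`) (apsnd f) ` (`) (Pair (0::nat)) ` edges H"
      unfolding f(2) by (simp add: image_image)
    ultimately show ?thesis
      by (intro union_isoI[of "apsnd f"]) (simp_all add: com_verts_UN union_edges_UN lessThan_Suc)
  qed
  have "union_iso (concat (map (\<lambda>K. [r K]) Gs)) (map (\<lambda>K. K) Gs)"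
    by (rule union_iso_concat) (use iso single in auto)
  then show ?thesis by simp
qed

text \<open>Forgetting the index of the piece is injective because the pieces share no vertices.\<close>

lemma union_iso_partition:
  assumes disjoint: "\<And>i j. i < length Gs \<Longrightarrow> j < length Gs \<Longrightarrow>
      verts (Gs ! i) \<inter> verts (Gs ! j) \<noteq> {} \<Longrightarrow> i = j"
    and V: "verts G = (\<Union>K\<in>set Gs. verts K)" and E: "edges G = (\<Union>K\<in>set Gs. edges K)"
  shows "union_iso Gs [G]"
proof -
  let ?\<phi> = "\<lambda>x :: nat \<times> nat. (0 :: nat, snd x)"
  have set: "set Gs = (!) Gs ` {..<length Gs}"
    by (auto simp: set_conv_nth)
  have "bij_betw ?\<phi> (com_verts Gs) (com_verts [G])"
  proof (rule bij_betw_imageI)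
    show "inj_on ?\<phi> (com_verts Gs)"
      using disjoint by (auto simp: inj_on_def com_verts_def)
    show "?\<phi> ` com_verts Gs = com_verts [G]"
      unfolding com_verts_UN by (simp add: V set image_UN image_image lessThan_Suc)
  qed
  moreover have "union_edges [G] = (`) ?\<phi> ` union_edges Gs"
    unfolding union_edges_UN by (simp add: E set image_UN image_image lessThan_Suc)
  ultimately show ?thesis by (rule union_isoI)
qed


section \<open>Connected components\<close>

lemma reach_sym: "(u, v) \<in> (adj G)\<^sup>* \<Longrightarrow> (v, u) \<in> (adj G)\<^sup>*"
  by (rule symD[OF sym_rtrancl]) (auto simp: sym_def adj_def insert_commute)

lemma component_verts_eq:
  assumes "w \<in> component_verts G v"
  shows "component_verts G w = component_verts G v"
  using assms reach_sym[of v w G] by (auto simp: component_verts_def intro: rtrancl_trans)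

lemma simple_component: "simple_graph G \<Longrightarrow> simple_graph (component G v)"
  by (auto simp: simple_graph_def component_def component_verts_def)

text \<open>A path of \<open>G\<close> starting at \<open>v\<close> never leaves the component of \<open>v\<close>, so its edges are edges of the
  component. Two vertices are then joined through \<open>v\<close>.\<close>

lemma connected_component:
  assumes G: "simple_graph G" and v: "v \<in> verts G"
  shows "connected_graph (component G v)"
proof -
  have from_v: "(v, w) \<in> (adj (component G v))\<^sup>*" if "(v, w) \<in> (adj G)\<^sup>*" for w
    using that
  proof (induction rule: rtrancl_induct)
    case base then show ?case by simp
  next
    case (step y z)
    have yz: "{y, z} \<in> edges G" using step(2) by (simp add: adj_def)
    then have "y \<in> verts G" "z \<in> verts G" using G by (auto simp: simple_graph_def)
    then have "{y, z} \<subseteq> component_verts G v"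
      using step(1,2) by (auto simp: component_verts_def intro: rtrancl_into_rtrancl)
    then have "(y, z) \<in> adj (component G v)" using yz by (simp add: adj_def component_def)
    then show ?case using step.IH by simp
  qed
  have "v \<in> verts (component G v)" using v by (simp add: component_def component_verts_def)
  moreover have "(v, u) \<in> (adj (component G v))\<^sup>*" if "u \<in> verts (component G v)" for u
    using that from_v by (simp add: component_def component_verts_def)
  ultimately show ?thesis
    unfolding connected_graph_def using reach_sym rtrancl_trans by (metis empty_iff)
qed

lemma component_list_cases:
  assumes "simple_graph G" "K \<in> set (component_list G)"
  obtains v where "v \<in> verts G" "K = component G v"
  using assms by (auto simp: component_list_def simple_graph_def)

text \<open>Reachability is an equivalence relation, so the components partition the vertices, and every
  edge lies within one of them. Listing a component through its least vertex picks each class exactly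
  once.\<close>

lemma union_iso_component_list:
  assumes G: "simple_graph G"
  shows "union_iso (component_list G) [G]"
proof (rule union_iso_partition)
  let ?V = "component_verts G"
  have fin: "finite (verts G)" using G by (simp add: simple_graph_def)
  define vs where "vs = filter (\<lambda>v. v = Min (?V v)) (sorted_list_of_set (verts G))"
  have list: "component_list G = map (component G) vs"
    by (simp add: component_list_def vs_def)
  have vs: "v \<in> set vs \<longleftrightarrow> v \<in> verts G \<and> v = Min (?V v)" for v
    using fin by (simp add: vs_def)
  have dist: "distinct vs" by (simp add: vs_def)
  have least: "\<exists>v\<in>set vs. ?V v = ?V u" if u: "u \<in> verts G" for u
  proof -
    have "finite (?V u)" "?V u \<noteq> {}" using fin u by (auto simp: component_verts_def)
    then have m: "Min (?V u) \<in> ?V u" by (rule Min_in)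
    then have "?V (Min (?V u)) = ?V u" by (rule component_verts_eq)
    moreover have "Min (?V u) \<in> verts G" using m by (simp add: component_verts_def)
    ultimately show ?thesis using vs by metis
  qed
  show "i = j" if "i < length (component_list G)" "j < length (component_list G)"
    and meet: "verts (component_list G ! i) \<inter> verts (component_list G ! j) \<noteq> {}" for i j
  proof -
    have ij: "i < length vs" "j < length vs" using that by (simp_all add: list)
    then obtain u where "u \<in> ?V (vs ! i)" "u \<in> ?V (vs ! j)"
      using meet by (auto simp: list component_def)
    then have "?V (vs ! i) = ?V (vs ! j)" using component_verts_eq by metis
    then have "vs ! i = vs ! j" using vs ij by (metis nth_mem)
    then show ?thesis using dist ij by (simp add: nth_eq_iff_index_eq)
  qed
  show "verts G = (\<Union>K\<in>set (component_list G). verts K)"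
  proof (intro subset_antisym subsetI)
    fix u assume u: "u \<in> verts G"
    then have "u \<in> ?V u" by (simp add: component_verts_def)
    then show "u \<in> (\<Union>K\<in>set (component_list G). verts K)"
      using least[OF u] by (auto simp: list component_def)
  qed (auto simp: list component_def component_verts_def)
  show "edges G = (\<Union>K\<in>set (component_list G). edges K)"
  proof (intro subset_antisym subsetI)
    fix e assume e: "e \<in> edges G"
    obtain x y where xy: "e = {x, y}" "x \<in> verts G" "y \<in> verts G"
      using simple_graph_edge_cases[OF G e] by metis
    have "(x, y) \<in> adj G" using e xy(1) by (simp add: adj_def)
    then have "e \<subseteq> ?V x" using xy by (auto simp: component_verts_def)
    then show "e \<in> (\<Union>K\<in>set (component_list G). edges K)"
      using least[OF xy(2)] e by (auto simp: list component_def)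
  qed (auto simp: list component_def)
qed

lemma representative_iso:
  assumes H: "community_graphs \<H>" and G: "simple_graph G" "connected_graph G"
  shows "representative \<H> G \<in> \<H>" "graph_iso G (representative \<H> G)"
proof -
  have "\<exists>!K. K \<in> \<H> \<and> graph_iso G K"
  proof (rule ex_ex1I)
    show "\<exists>K. K \<in> \<H> \<and> graph_iso G K"
      using H G unfolding community_graphs_def by blast
    fix K K' assume K: "K \<in> \<H> \<and> graph_iso G K" "K' \<in> \<H> \<and> graph_iso G K'"
    then have "graph_iso K K'" using graph_iso_sym graph_iso_trans by blast
    then show "K = K'" using H K unfolding community_graphs_def by blast
  qed
  then have "representative \<H> G \<in> \<H> \<and> graph_iso G (representative \<H> G)"
    unfolding representative_def by (rule theI')
  then show "representative \<H> G \<in> \<H>" "graph_iso G (representative \<H> G)" by blast+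
qed

lemma union_iso_representatives:
  assumes H: "community_graphs \<H>" and G: "simple_graph G"
  shows "simple_graphs (map (representative \<H>) (component_list G))"
    and "union_iso (map (representative \<H>) (component_list G)) [G]"
proof -
  have iso: "graph_iso (representative \<H> K) K \<and> simple_graph (representative \<H> K) \<and> simple_graph K"
    if K: "K \<in> set (component_list G)" for K
  proof -
    obtain v where v: "v \<in> verts G" "K = component G v"
      using component_list_cases[OF G K] by metis
    have K: "simple_graph K" "connected_graph K"
      using simple_component[OF G] connected_component[OF G] v by auto
    show ?thesis
      using representative_iso[OF H K] K graph_iso_sym H unfolding community_graphs_def by blast
  qed
  then show "simple_graphs (map (representative \<H>) (component_list G))" by simp
  show "union_iso (map (representative \<H>) (component_list G)) [G]"
    using union_iso_pointwise[OF iso] union_iso_component_list[OF G] by (rule union_iso_trans)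
qed


section \<open>The two percolated graphs\<close>

definition component_communities ::
  "graph set \<Rightarrow> graph list \<Rightarrow> (nat \<times> nat set \<Rightarrow> bool) \<Rightarrow> graph list" where
  "component_communities \<H> C R =
     concat (map (\<lambda>a. map (representative \<H>) (component_list (retained_com C R a))) [0..<length C])"

text \<open>Splitting into components preserves the law conditionally on the outcome \<open>R\<close> of the percolation:
  both lists describe the same disjoint union up to isomorphism.\<close>

lemma RIGC_component_communities:
  assumes H: "community_graphs \<H>" and C: "simple_graphs C"
    and ne: "matchings N d C \<noteq> {}" "finite (matchings N d C)"
  shows "RIGC N d (component_communities \<H> C R) = RIGC N d (retained_list C R)"
proof (rule RIGC_union_iso)
  let ?g = "\<lambda>a. map (representative \<H>) (component_list (retained_com C R a))"
  have "simple_graph (retained_com C R a)" if "a < length C" for a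
    using simple_retained[OF C, of R] that by (simp add: retained_list_def)
  then have g: "simple_graphs (?g a) \<and> union_iso (?g a) [retained_com C R a]"
    if "a \<in> set [0..<length C]" for a
    using union_iso_representatives[OF H] that by (metis atLeastLessThan_iff set_upt)
  show "simple_graphs (component_communities \<H> C R)"
    using g unfolding component_communities_def by fastforce
  show "simple_graphs (retained_list C R)" using C by (rule simple_retained)
  show "union_iso (component_communities \<H> C R) (retained_list C R)"
    unfolding component_communities_def retained_list_def using g by (rule union_iso_concat)
qed (simp_all add: matchings_retained ne)

theorem proposition4p1:
  fixes \<H> :: "graph set" and N :: nat and d :: "nat \<Rightarrow> nat" and Com :: "graph list" and p :: real
  assumes "community_graphs \<H>"
    and "\<forall>v\<in>{1..N}. d v > 0"
    and "set Com \<subseteq> \<H>"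
    and "(\<Sum>v\<in>{1..N}. d v) = (\<Sum>a<length Com. card (verts (Com ! a)))"
    and "p \<in> {0..1}"
  shows "bind_pmf (RIGC N d Com) (percolate_multigraph p N) =
         bind_pmf (percolate_com \<H> p Com) (RIGC N d)"
proof -
  have C: "simple_graphs Com" using assms(1,3) by (auto simp: community_graphs_def)
  note ne = matchings_nonempty_finite[OF C assms(4)]
  let ?M = "pmf_of_set (matchings N d Com)"
  let ?Q = "Pi_pmf (com_edges Com) False (\<lambda>_. bernoulli_pmf p)"
  have "bind_pmf (RIGC N d Com) (percolate_multigraph p N) =
      bind_pmf ?M (\<lambda>\<omega>. percolate_multigraph p N (rigc_mult N d Com \<omega>))"
    by (simp add: RIGC_def bind_map_pmf)
  also have "\<dots> = bind_pmf ?M (\<lambda>\<omega>. bind_pmf ?Q (\<lambda>R. return_pmf (rigc_mult N d (retained_list Com R) \<omega>)))"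
    by (intro bind_pmf_cong refl)
      (simp add: ne percolate_rigc_mult[OF _ C] map_pmf_def)
  also have "\<dots> = bind_pmf ?Q (\<lambda>R. bind_pmf ?M (\<lambda>\<omega>. return_pmf (rigc_mult N d (retained_list Com R) \<omega>)))"
    by (rule bind_commute_pmf)
  also have "\<dots> = bind_pmf ?Q (\<lambda>R. RIGC N d (retained_list Com R))"
    by (simp add: RIGC_def map_pmf_def matchings_retained)
  also have "\<dots> = bind_pmf ?Q (\<lambda>R. RIGC N d (component_communities \<H> Com R))"
    by (simp add: RIGC_component_communities[OF assms(1) C ne])
  also have "\<dots> = bind_pmf (percolate_com \<H> p Com) (RIGC N d)"
    by (simp add: percolate_com_def component_communities_def bind_map_pmf)
  finally show ?thesis .
qed

end
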